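(* Let $\mathbb{M}$ be a local Moufang set with little projective group $G$, let $0,\infty\in X$ be non-equivalent points, let $\tau$ be a $\mu$-map, and let $H$ be the Hua subgroup. Then $$G = U_0 H U_\infty\,\cup\,U_0 H\tau U_0^\circ ,$$ and hence $G_0=U_0H$ and $H=G_{0,\infty}$, where $G_0$ is the stabilizer of $0$ in $G$ and $G_{0,\infty}$ is the stabilizer in $G$ of both $0$ and $\infty$.
   Context: Conventions: all actions are on the right, $xg$ (or $x\cdot g$) is the image of $x$ under $g$, products are composed left to right, $g^h=h^{-1}gh$. For a set with an equivalence relation $(X,\sim)$, $\overline{x}$ is the class of $x$, $\overline{X}$ is the set of classes, and $\mathrm{Sym}(X,\sim)$ is the group of permutations of $X$ preserving the equivalence relation. A local Moufang set consists of $(X,\sim)$ with $|\overline{X}|>2$ and subgroups $U_x\le\mathrm{Sym}(X,\sim)$ for $x\in X$ (root groups). Write $U_{\overline{x}}$ for the image of $U_x$ in $\mathrm{Sym}(\overline{X})$ and $G=\langle U_x\mid x\in X\rangle$ (the little projective group). The axioms are: (LM1) if $x\sim y$ then $U_{\overline{x}}=U_{\overline{y}}$; (LM2) for $x\in X$, $U_x$ fixes $x$ and acts sharply transitively on $X\setminus\overline{x}$; (LM2') for $\overline{x}\in\overline{X}$, $U_{\overline{x}}$ fixes $\overline{x}$ and acts sharply transitively on $\overline{X}\setminus\{\overline{x}\}$; (LM3) $U_x^g=U_{xg}$ for all $x\in X$, $g\in G$. $U_x^\circ:=\ker(U_x\to U_{\overline{x}})$. Fix $0,\infty\in X$ with $0\nsim\infty$.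 For $x\nsim\infty$, $\alpha_x$ is the unique element of $U_\infty$ mapping $0$ to $x$. A unit is an $x\in X$ with $x\nsim0$, $x\nsim\infty$. For a unit $x$, $\mu_x$ is the unique element of $U_0\alpha_xU_0$ interchanging $0$ and $\infty$ (it exists and is unique); such elements are called $\mu$-maps. The Hua subgroup is $H=\langle\mu_x\mu_y\mid x,y\text{ units}\rangle$. *)

theory Defs
  imports "HOL-Algebra.Generated_Groups" "HOL-Combinatorics.Permutations"
begin

(* Actions are on the right: the image of x under g is the function value g x, and the
   product of g and h is "first g, then h", that is h \<circ> g as functions. *)

definition sym_set :: "'a set \<Rightarrow> ('a \<Rightarrow> 'a) monoid" where
  "sym_set Y = \<lparr>carrier = {g. g permutes Y}, monoid.mult = (\<lambda>g h. h \<circ> g), monoid.one = id\<rparr>"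

definition sym_rel :: "'a set \<Rightarrow> ('a \<times> 'a) set \<Rightarrow> ('a \<Rightarrow> 'a) monoid" where
  "sym_rel X r = (sym_set X)
     \<lparr>carrier := {g \<in> carrier (sym_set X). \<forall>x\<in>X. \<forall>y\<in>X. (x, y) \<in> r \<longleftrightarrow> (g x, g y) \<in> r}\<rparr>"

(* The homomorphism from sym_rel X r to sym_set (X // r).  Outside of X // r it has to be the
   identity, as required by permutes. *)
definition induced :: "'a set \<Rightarrow> ('a \<times> 'a) set \<Rightarrow> ('a \<Rightarrow> 'a) \<Rightarrow> ('a set \<Rightarrow> 'a set)" where
  "induced X r g = (\<lambda>C. if C \<in> X // r then g ` C else C)"

definition sharply_transitive_on :: "('a \<Rightarrow> 'a) set \<Rightarrow> 'a set \<Rightarrow> bool" where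
  "sharply_transitive_on A Y \<longleftrightarrow>
     (\<forall>u\<in>A. \<forall>y\<in>Y. u y \<in> Y) \<and> (\<forall>y\<in>Y. \<forall>z\<in>Y. \<exists>!u. u \<in> A \<and> u y = z)"

definition little_projective_group ::
  "'a set \<Rightarrow> ('a \<times> 'a) set \<Rightarrow> ('a \<Rightarrow> ('a \<Rightarrow> 'a) set) \<Rightarrow> ('a \<Rightarrow> 'a) set" where
  "little_projective_group X r U = generate (sym_rel X r) (\<Union>x\<in>X. U x)"

(* U is only relevant on X. *)
locale local_moufang_set =
  fixes X :: "'a set" and r :: "('a \<times> 'a) set" and U :: "'a \<Rightarrow> ('a \<Rightarrow> 'a) set"
  assumes equiv: "equiv X r"
    and more_than_two_classes: "infinite (X // r) \<or> card (X // r) > 2"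
    and root_subgroup: "x \<in> X \<Longrightarrow> subgroup (U x) (sym_rel X r)"
    and LM1: "(x, y) \<in> r \<Longrightarrow> induced X r ` U x = induced X r ` U y"
    and LM2_fix: "\<lbrakk>x \<in> X; u \<in> U x\<rbrakk> \<Longrightarrow> u x = x"
    and LM2: "x \<in> X \<Longrightarrow> sharply_transitive_on (U x) (X - r `` {x})"
    and LM2'_fix: "\<lbrakk>x \<in> X; v \<in> induced X r ` U x\<rbrakk> \<Longrightarrow> v (r `` {x}) = r `` {x}"
    and LM2': "x \<in> X \<Longrightarrow> sharply_transitive_on (induced X r ` U x) (X // r - {r `` {x}})"
    and LM3: "\<lbrakk>x \<in> X; g \<in> little_projective_group X r U\<rbrakk> \<Longrightarrow>
      (\<lambda>u. inv\<^bsub>sym_rel X r\<^esub> g \<otimes>\<^bsub>sym_rel X r\<^esub> u \<otimes>\<^bsub>sym_rel X r\<^esub> g) ` U x = U (g x)"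

definition root_kernel ::
  "'a set \<Rightarrow> ('a \<times> 'a) set \<Rightarrow> ('a \<Rightarrow> ('a \<Rightarrow> 'a) set) \<Rightarrow> 'a \<Rightarrow> ('a \<Rightarrow> 'a) set" where
  "root_kernel X r U x =
     kernel ((sym_rel X r)\<lparr>carrier := U x\<rparr>) (sym_set (X // r)) (induced X r)"

(* In the following, p0 and pinf are the two base points 0 and \<infinity>. *)

definition units :: "'a set \<Rightarrow> ('a \<times> 'a) set \<Rightarrow> 'a \<Rightarrow> 'a \<Rightarrow> 'a set" where
  "units X r p0 pinf = {x \<in> X. (x, p0) \<notin> r \<and> (x, pinf) \<notin> r}"

(* Meaningful for x in X not equivalent to pinf; see ex1_alpha. *)
definition alpha :: "('a \<Rightarrow> ('a \<Rightarrow> 'a) set) \<Rightarrow> 'a \<Rightarrow> 'a \<Rightarrow> 'a \<Rightarrow> 'a \<Rightarrow> 'a" where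
  "alpha U p0 pinf x = (THE u. u \<in> U pinf \<and> u p0 = x)"

(* Meaningful for units x; see ex1_mu. *)
definition mu ::
  "'a set \<Rightarrow> ('a \<times> 'a) set \<Rightarrow> ('a \<Rightarrow> ('a \<Rightarrow> 'a) set) \<Rightarrow> 'a \<Rightarrow> 'a \<Rightarrow> 'a \<Rightarrow> 'a \<Rightarrow> 'a" where
  "mu X r U p0 pinf x = (THE m.
     m \<in> U p0 #>\<^bsub>sym_rel X r\<^esub> alpha U p0 pinf x <#>\<^bsub>sym_rel X r\<^esub> U p0 \<and> m p0 = pinf \<and> m pinf = p0)"

definition mu_maps ::
  "'a set \<Rightarrow> ('a \<times> 'a) set \<Rightarrow> ('a \<Rightarrow> ('a \<Rightarrow> 'a) set) \<Rightarrow> 'a \<Rightarrow> 'a \<Rightarrow> ('a \<Rightarrow> 'a) set" where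
  "mu_maps X r U p0 pinf = mu X r U p0 pinf ` units X r p0 pinf"

definition hua_subgroup ::
  "'a set \<Rightarrow> ('a \<times> 'a) set \<Rightarrow> ('a \<Rightarrow> ('a \<Rightarrow> 'a) set) \<Rightarrow> 'a \<Rightarrow> 'a \<Rightarrow> ('a \<Rightarrow> 'a) set" where
  "hua_subgroup X r U p0 pinf = generate (sym_rel X r)
     {mu X r U p0 pinf x \<otimes>\<^bsub>sym_rel X r\<^esub> mu X r U p0 pinf y | x y. x \<in> units X r p0 pinf \<and> y \<in> units X r p0 pinf}"

lemma group_sym_set: "group (sym_set Y)"
proof (rule groupI)
  fix g assume "g \<in> carrier (sym_set Y)"
  then show "\<exists>h\<in>carrier (sym_set Y). h \<otimes>\<^bsub>sym_set Y\<^esub> g = \<one>\<^bsub>sym_set Y\<^esub>"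
    by (intro bexI[of _ "inv_into UNIV g"])
      (auto simp: sym_set_def permutes_inv permutes_inv_o)
qed (simp_all add: sym_set_def permutes_compose comp_assoc)

lemma sym_rel_iff:
  "g \<in> carrier (sym_rel X r) \<longleftrightarrow>
     g permutes X \<and> (\<forall>x\<in>X. \<forall>y\<in>X. (x, y) \<in> r \<longleftrightarrow> (g x, g y) \<in> r)"
  by (simp add: sym_rel_def sym_set_def)

lemma subgroup_sym_rel: "subgroup (carrier (sym_rel X r)) (sym_set X)"
proof (rule group.subgroupI[OF group_sym_set])
  fix g assume g: "g \<in> carrier (sym_rel X r)"
  then have p: "g permutes X" by (simp add: sym_rel_iff)
  have "(inv_into UNIV g) \<in> carrier (sym_rel X r)"
    using g p permutes_inverses[OF p] permutes_in_image[OF permutes_inv[OF p]]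
    by (auto simp: sym_rel_def sym_set_def permutes_inv)
  moreover have "inv\<^bsub>sym_set X\<^esub> g = inv_into UNIV g"
    by (rule group.inv_equality[OF group_sym_set])
      (use p in \<open>auto simp: sym_set_def permutes_inv permutes_inv_o\<close>)
  ultimately show "inv\<^bsub>sym_set X\<^esub> g \<in> carrier (sym_rel X r)" by simp
next
  have "id \<in> carrier (sym_rel X r)" by (simp add: sym_rel_def sym_set_def permutes_id)
  then show "carrier (sym_rel X r) \<noteq> {}" by blast
next
  show "carrier (sym_rel X r) \<subseteq> carrier (sym_set X)" by (simp add: sym_rel_def)
next
  fix g h assume gh: "g \<in> carrier (sym_rel X r)" "h \<in> carrier (sym_rel X r)"
  then have p: "g permutes X" "h permutes X" by (simp_all add: sym_rel_iff)
  show "g \<otimes>\<^bsub>sym_set X\<^esub> h \<in> carrier (sym_rel X r)"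
  proof -
    have "(x, y) \<in> r \<longleftrightarrow> (h (g x), h (g y)) \<in> r" if "x \<in> X" "y \<in> X" for x y
    proof -
      have "(x, y) \<in> r \<longleftrightarrow> (g x, g y) \<in> r" using gh(1) that unfolding sym_rel_iff by blast
      moreover have "g x \<in> X" "g y \<in> X" using permutes_in_image[OF p(1)] that by auto
      ultimately show ?thesis using gh(2) unfolding sym_rel_iff by blast
    qed
    then have "h \<circ> g \<in> carrier (sym_rel X r)"
      unfolding sym_rel_iff using permutes_compose[OF p] by simp
    then show ?thesis by (simp add: sym_set_def)
  qed
qed

lemma group_sym_rel: "group (sym_rel X r)"
proof -
  have "(sym_set X)\<lparr>carrier := carrier (sym_rel X r)\<rparr> = sym_rel X r"
    by (simp add: sym_rel_def)
  then show ?thesis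
    using group.subgroup_imp_group[OF group_sym_set subgroup_sym_rel, of X r] by simp
qed

lemma induced_class:
  assumes "equiv X r" "g \<in> carrier (sym_rel X r)" "x \<in> X"
  shows "induced X r g (r `` {x}) = r `` {g x}"
proof -
  have p: "g permutes X" using assms by (simp add: sym_rel_iff)
  have iff: "(x, y) \<in> r \<longleftrightarrow> (g x, g y) \<in> r" if "y \<in> X" for y
    using assms that unfolding sym_rel_iff by blast
  have sub: "r \<subseteq> X \<times> X" using assms(1) by (simp add: equiv_def)
  have "r `` {g x} \<subseteq> g ` (r `` {x})"
  proof
    fix z assume z: "z \<in> r `` {g x}"
    then obtain y where y: "z = g y" "y \<in> X"
      using sub permutes_image[OF p] by blast
    then show "z \<in> g ` (r `` {x})" using z iff by auto
  qed
  moreover have "g ` (r `` {x}) \<subseteq> r `` {g x}" using iff sub by blast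
  ultimately show ?thesis using assms(3) by (auto simp: induced_def quotientI)
qed

context local_moufang_set
begin

lemma ex1_alpha:
  assumes "p0 \<in> X" "pinf \<in> X" "(p0, pinf) \<notin> r" "x \<in> X" "(x, pinf) \<notin> r"
  shows "\<exists>!u. u \<in> U pinf \<and> u p0 = x"
proof -
  have "(pinf, p0) \<notin> r" "(pinf, x) \<notin> r"
    using equiv assms by (meson equiv_def symD)+
  then show ?thesis using LM2[OF assms(2)] assms by (auto simp: sharply_transitive_on_def)
qed

lemma alpha_props:
  assumes "p0 \<in> X" "pinf \<in> X" "(p0, pinf) \<notin> r" "x \<in> X" "(x, pinf) \<notin> r"
  shows "alpha U p0 pinf x \<in> U pinf" "alpha U p0 pinf x p0 = x"
  using theI'[OF ex1_alpha[OF assms]] by (auto simp: alpha_def)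

lemma ex1_mu:
  assumes "p0 \<in> X" "pinf \<in> X" "(p0, pinf) \<notin> r" "x \<in> units X r p0 pinf"
  shows "\<exists>!m. m \<in> U p0 #>\<^bsub>sym_rel X r\<^esub> alpha U p0 pinf x <#>\<^bsub>sym_rel X r\<^esub> U p0 \<and> m p0 = pinf \<and> m pinf = p0"
proof -
  let ?a = "alpha U p0 pinf x"
  have x: "x \<in> X" "(x, p0) \<notin> r" "(x, pinf) \<notin> r" using assms by (auto simp: units_def)
  have s: "sym r" using equiv by (simp add: equiv_def)
  have nr: "(p0, x) \<notin> r" "(pinf, x) \<notin> r" "(pinf, p0) \<notin> r" using s x assms by (meson symD)+
  have a: "?a \<in> U pinf" "?a p0 = x" using alpha_props[OF assms(1-3)] x by auto
  have "?a \<in> carrier (sym_rel X r)"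
    using a root_subgroup[OF assms(2)] by (auto dest: subgroup.mem_carrier)
  then have pa: "?a permutes X" and ra: "\<And>y z. y \<in> X \<Longrightarrow> z \<in> X \<Longrightarrow> (y, z) \<in> r \<longleftrightarrow> (?a y, ?a z) \<in> r"
    unfolding sym_rel_iff by blast+
  obtain w where w: "?a w = p0" "w \<in> X" using permutes_image[OF pa] assms(1) by (metis imageE)
  have wo: "(p0, w) \<notin> r" using ra[OF assms(1) w(2)] a(2) w(1) x(2) by simp
  have tr: "\<exists>!u. u \<in> U p0 \<and> u y = z" if "y \<in> X" "(p0, y) \<notin> r" "z \<in> X" "(p0, z) \<notin> r" for y z
    using LM2[OF assms(1)] that by (simp add: sharply_transitive_on_def)
  obtain u where u: "u \<in> U p0" "u pinf = w" and uu: "\<And>u'. u' \<in> U p0 \<Longrightarrow> u' pinf = w \<Longrightarrow> u' = u"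
    using tr[OF assms(2,3) w(2) wo] by blast
  obtain v where v: "v \<in> U p0" "v x = pinf" and vv: "\<And>v'. v' \<in> U p0 \<Longrightarrow> v' x = pinf \<Longrightarrow> v' = v"
    using tr[OF x(1) nr(1) assms(2,3)] by blast
  have mem: "m \<in> U p0 #>\<^bsub>sym_rel X r\<^esub> ?a <#>\<^bsub>sym_rel X r\<^esub> U p0
      \<longleftrightarrow> (\<exists>u'\<in>U p0. \<exists>v'\<in>U p0. m = v' \<circ> (?a \<circ> u'))" for m
    by (auto simp: r_coset_def set_mult_def sym_rel_def sym_set_def)
  show ?thesis unfolding mem
  proof (rule ex1I[of _ "v \<circ> (?a \<circ> u)"])
    show "(\<exists>u'\<in>U p0. \<exists>v'\<in>U p0. v \<circ> (?a \<circ> u) = v' \<circ> (?a \<circ> u')) \<and>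
      (v \<circ> (?a \<circ> u)) p0 = pinf \<and> (v \<circ> (?a \<circ> u)) pinf = p0"
      using u v w(1) a(2) LM2_fix[OF assms(1) u(1)] LM2_fix[OF assms(1) v(1)] by auto
  next
    fix m assume m: "(\<exists>u'\<in>U p0. \<exists>v'\<in>U p0. m = v' \<circ> (?a \<circ> u')) \<and> m p0 = pinf \<and> m pinf = p0"
    then obtain u' v' where e: "u' \<in> U p0" "v' \<in> U p0" "m = v' \<circ> (?a \<circ> u')" by blast
    have v'eq: "v' = v" using vv[of v'] e m a(2) LM2_fix[OF assms(1) e(1)] by simp
    have "v permutes X"
      using subgroup.mem_carrier[OF root_subgroup[OF assms(1)] v(1)] by (simp add: sym_rel_iff)
    then have "inj v" by (rule permutes_inj)
    moreover have "v (?a (u' pinf)) = v p0" using m e(3) v'eq LM2_fix[OF assms(1) v(1)] by simp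
    ultimately have "?a (u' pinf) = ?a w" using w by (simp add: inj_eq)
    then have "u' pinf = w" using permutes_inj[OF pa] by (simp add: inj_eq)
    then show "m = v \<circ> (?a \<circ> u)" using uu e v'eq by blast
  qed
qed

end

end

theory Submission
  imports Defs
begin

text \<open>
  Write \<open>K = U_0 H\<close>. Since \<open>G\<close> is generated by \<open>U_0\<close> and \<open>\<tau>\<close>, it suffices that
  \<open>Q = K U_\<infinity> \<union> K \<tau> U_0\<close> is stable under right multiplication by these.
  The substantial point is \<open>U_\<infinity> U_0 \<subseteq> Q\<close>. If \<open>a \<in> U_\<infinity>\<close> acts nontrivially on classes, then
  \<open>a \<in> U_0 \<mu>_x U_0\<close> for some unit \<open>x\<close>, and \<open>\<mu>_x \<in> H \<tau>\<close>. Dually, \<open>u \<in> U_0\<close> acting nontrivially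
  on classes lies in \<open>U_\<infinity> \<mu>_y U_\<infinity>\<close>; for \<open>a\<close> acting trivially on classes this turns \<open>a u\<close> into
  \<open>c \<mu>_y b\<close> with \<open>c \<in> U_\<infinity>\<close> nontrivial on classes, so \<open>a u \<in> U_0 \<mu>_x U_0 \<mu>_y U_\<infinity> \<subseteq> K U_\<infinity>\<close>.
  If both act trivially on classes, write \<open>u\<close> as a product of two elements that do not.
\<close>

section \<open>Sharp transitivity, words in the ambient group, and the root groups\<close>

lemma sharply_transitive_on_unique:
  assumes "sharply_transitive_on A Y" "u \<in> A" "v \<in> A" "y \<in> Y" "u y = v y"
  shows "u = v"
proof -
  have "v y \<in> Y" using assms(1,3,4) by (simp add: sharply_transitive_on_def)
  then have "\<exists>!w. w \<in> A \<and> w y = v y"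
    using assms(1,4) by (simp add: sharply_transitive_on_def)
  then show ?thesis using assms(2,3,5) by (elim ex1E) metis
qed

context local_moufang_set
begin

abbreviation S where "S \<equiv> sym_rel X r"
abbreviation G where "G \<equiv> little_projective_group X r U"
abbreviation gmult (infixl "\<cdot>" 70) where "g \<cdot> h \<equiv> g \<otimes>\<^bsub>S\<^esub> h"
abbreviation ginv where "ginv g \<equiv> inv\<^bsub>S\<^esub> g"

sublocale S: group S
  by (rule group_sym_rel)

lemma mult_apply: "(g \<cdot> h) p = h (g p)"
  by (simp add: sym_rel_def sym_set_def)

lemma one_apply: "\<one>\<^bsub>S\<^esub> p = p"
  by (simp add: sym_rel_def sym_set_def)

text \<open>Right association leaves an inverse pair in front of a tail \<open>h\<close>, where the
  plain inverse laws no longer match. With these rules \<open>word_simps\<close> decides the word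
  identities below.\<close>

lemma cancel:
  assumes "g \<in> carrier S" "h \<in> carrier S"
  shows "ginv g \<cdot> (g \<cdot> h) = h" "g \<cdot> (ginv g \<cdot> h) = h"
  using assms by (simp_all flip: S.m_assoc)

lemmas word_simps = S.m_assoc S.inv_mult_group cancel

lemma inv_apply: "g \<in> carrier S \<Longrightarrow> ginv g (g p) = p"
  by (metis mult_apply one_apply S.r_inv)

lemma apply_inv: "g \<in> carrier S \<Longrightarrow> g (ginv g p) = p"
  by (metis mult_apply one_apply S.l_inv)

lemma apply_eq_iff: "g \<in> carrier S \<Longrightarrow> g x = g y \<longleftrightarrow> x = y"
  by (metis inv_apply)

lemma apply_in: "g \<in> carrier S \<Longrightarrow> x \<in> X \<Longrightarrow> g x \<in> X"
  by (simp add: sym_rel_iff permutes_in_image)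

lemma apply_rel: "g \<in> carrier S \<Longrightarrow> x \<in> X \<Longrightarrow> y \<in> X \<Longrightarrow> (g x, g y) \<in> r \<longleftrightarrow> (x, y) \<in> r"
  unfolding sym_rel_iff by blast

lemma rel_sym: "(x, y) \<in> r \<longleftrightarrow> (y, x) \<in> r"
  using equiv by (meson equiv_def symD)

lemma rel_trans: "(x, y) \<in> r \<Longrightarrow> (y, z) \<in> r \<Longrightarrow> (x, z) \<in> r"
  using equiv by (meson equiv_def transD)

lemma rel_refl: "x \<in> X \<Longrightarrow> (x, x) \<in> r"
  using equiv by (meson equiv_def refl_onD)

lemma root_carrier: "x \<in> X \<Longrightarrow> u \<in> U x \<Longrightarrow> u \<in> carrier S"
  by (rule subgroup.mem_carrier[OF root_subgroup])

lemma root_mult: "x \<in> X \<Longrightarrow> u \<in> U x \<Longrightarrow> v \<in> U x \<Longrightarrow> u \<cdot> v \<in> U x"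
  by (rule subgroup.m_closed[OF root_subgroup])

lemma root_inv: "x \<in> X \<Longrightarrow> u \<in> U x \<Longrightarrow> ginv u \<in> U x"
  by (rule subgroup.m_inv_closed[OF root_subgroup])

lemma root_one: "x \<in> X \<Longrightarrow> \<one>\<^bsub>S\<^esub> \<in> U x"
  by (rule subgroup.one_closed[OF root_subgroup])

lemma ex_root:
  assumes "x \<in> X" "y \<in> X" "z \<in> X" "(x, y) \<notin> r" "(x, z) \<notin> r"
  obtains u where "u \<in> U x" "u y = z"
  using LM2[OF assms(1)] assms unfolding sharply_transitive_on_def by blast

lemma root_unique:
  assumes "x \<in> X" "y \<in> X" "(x, y) \<notin> r" "u \<in> U x" "v \<in> U x" "u y = v y"
  shows "u = v"
  by (rule sharply_transitive_on_unique[OF LM2[OF assms(1)]]) (use assms in auto)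

lemma root_nrel:
  assumes "x \<in> X" "y \<in> X" "(x, y) \<notin> r" "u \<in> U x"
  shows "(x, u y) \<notin> r"
  using LM2[OF assms(1)] assms unfolding sharply_transitive_on_def by auto

lemma subgroup_G: "subgroup G S"
  unfolding little_projective_group_def
  by (rule S.generate_is_subgroup) (use root_carrier in blast)

lemma G_carrier: "g \<in> G \<Longrightarrow> g \<in> carrier S"
  by (rule subgroup.mem_carrier[OF subgroup_G])

lemma G_mult: "g \<in> G \<Longrightarrow> h \<in> G \<Longrightarrow> g \<cdot> h \<in> G"
  by (rule subgroup.m_closed[OF subgroup_G])

lemma G_inv: "g \<in> G \<Longrightarrow> ginv g \<in> G"
  by (rule subgroup.m_inv_closed[OF subgroup_G])

lemma root_in_G: "x \<in> X \<Longrightarrow> u \<in> U x \<Longrightarrow> u \<in> G"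
  unfolding little_projective_group_def by (blast intro: generate.incl)

lemma root_conj:
  assumes "x \<in> X" "g \<in> G" "u \<in> U x" "g x = y"
  shows "ginv g \<cdot> u \<cdot> g \<in> U y"
  using LM3[OF assms(1,2)] assms(3,4) by blast

lemma root_conj_inv:
  assumes "x \<in> X" "g \<in> G" "u \<in> U y" "g x = y"
  shows "g \<cdot> u \<cdot> ginv g \<in> U x"
proof -
  have "y \<in> X" using apply_in G_carrier assms by blast
  moreover have "ginv g y = x" using inv_apply G_carrier assms by blast
  ultimately show ?thesis
    using root_conj[OF _ G_inv[OF assms(2)] assms(3)] G_carrier[OF assms(2)] by simp
qed

text \<open>By \<open>LM2'\<close>, an element of the induced root group that fixes one class other
  than that of \<open>x\<close> is the identity. Thus triviality on classes can be tested at a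
  single point \<open>y\<close>; below this is the other base point.\<close>

lemma root_kernel_iff:
  assumes "x \<in> X" "y \<in> X" "(x, y) \<notin> r"
  shows "u \<in> root_kernel X r U x \<longleftrightarrow> u \<in> U x \<and> (y, u y) \<in> r"
proof -
  have ind: "induced X r u (r `` {y}) = r `` {u y}" if "u \<in> U x" for u
    using induced_class[OF equiv root_carrier] that assms by blast
  have one: "induced X r \<one>\<^bsub>S\<^esub> = id"
    by (auto simp: induced_def one_apply fun_eq_iff)
  have cls: "r `` {y} \<in> X // r - {r `` {x}}"
    using assms eq_equiv_class_iff[OF equiv assms(1,2)] quotientI[of y X r] by auto
  have "induced X r u = id \<longleftrightarrow> (y, u y) \<in> r" if u: "u \<in> U x"
  proof
    assume "induced X r u = id"
    then have "r `` {u y} = r `` {y}" using ind[OF u] by simp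
    moreover have "u y \<in> X" using apply_in[OF root_carrier[OF assms(1) u] assms(2)] .
    ultimately show "(y, u y) \<in> r" using rel_refl by blast
  next
    assume "(y, u y) \<in> r"
    then have "r `` {u y} = r `` {y}" using equiv_class_eq[OF equiv] by metis
    then have "induced X r u (r `` {y}) = r `` {y}" using ind[OF u] by simp
    then show "induced X r u = id"
      using sharply_transitive_on_unique[OF LM2'[OF assms(1)] imageI[OF u]
        imageI[OF root_one[OF assms(1)]] cls] one by (simp add: id_def)
  qed
  then show ?thesis
    by (auto simp: root_kernel_def kernel_def sym_set_def)
qed

end

section \<open>Base points, \<mu>-maps and the Hua subgroup\<close>

locale based_local_moufang_set = local_moufang_set X r U
  for X :: "'a set" and r :: "('a \<times> 'a) set" and U :: "'a \<Rightarrow> ('a \<Rightarrow> 'a) set" +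
  fixes p0 pinf :: 'a
  assumes p0: "p0 \<in> X" and pinf: "pinf \<in> X" and nrel: "(p0, pinf) \<notin> r"
begin

abbreviation E where "E \<equiv> units X r p0 pinf"
abbreviation \<mu> where "\<mu> \<equiv> mu X r U p0 pinf"
abbreviation H where "H \<equiv> hua_subgroup X r U p0 pinf"

lemma nrel': "(pinf, p0) \<notin> r"
  using nrel rel_sym by blast

text \<open>Without units, the classes of \<open>p0\<close> and \<open>pinf\<close> would be the
  only ones.\<close>

lemma ex_unit: "\<exists>x. x \<in> E"
proof (rule ccontr)
  assume no: "\<nexists>x. x \<in> E"
  have sub: "X // r \<subseteq> {r `` {p0}, r `` {pinf}}"
  proof
    fix C assume "C \<in> X // r"
    then obtain x where x: "x \<in> X" "C = r `` {x}" by (auto elim: quotientE)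
    then have "(x, p0) \<in> r \<or> (x, pinf) \<in> r" using no by (auto simp: units_def)
    then show "C \<in> {r `` {p0}, r `` {pinf}}"
      using x equiv_class_eq[OF equiv] by blast
  qed
  then have "finite (X // r)" by (rule finite_subset) simp
  moreover have "card (X // r) \<le> 2"
    using card_mono[OF _ sub] card_insert_le_m1[of 2 "{r `` {pinf}}" "r `` {p0}"] by simp
  ultimately show False using more_than_two_classes by simp
qed

lemma mu_props:
  assumes "x \<in> E"
  shows "\<exists>w\<in>U p0. \<exists>v\<in>U p0. \<mu> x = w \<cdot> alpha U p0 pinf x \<cdot> v"
    and "\<mu> x p0 = pinf" and "\<mu> x pinf = p0"
  using theI'[OF ex1_mu[OF p0 pinf nrel assms]]
  by (auto simp: mu_def r_coset_def set_mult_def)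

lemma mu_in_G: assumes "x \<in> E" shows "\<mu> x \<in> G"
proof -
  have "alpha U p0 pinf x \<in> U pinf"
    using alpha_props[OF p0 pinf nrel] assms by (auto simp: units_def)
  then show ?thesis
    using mu_props(1)[OF assms] root_in_G p0 pinf G_mult by metis
qed

lemma mu_carrier: "x \<in> E \<Longrightarrow> \<mu> x \<in> carrier S"
  using mu_in_G G_carrier by blast

lemma subgroup_H: "subgroup H S"
  unfolding hua_subgroup_def
  by (rule S.generate_is_subgroup) (use mu_carrier in auto)

lemma H_carrier: "h \<in> H \<Longrightarrow> h \<in> carrier S"
  by (rule subgroup.mem_carrier[OF subgroup_H])

lemma H_mult: "g \<in> H \<Longrightarrow> h \<in> H \<Longrightarrow> g \<cdot> h \<in> H"
  by (rule subgroup.m_closed[OF subgroup_H])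

lemma H_inv: "g \<in> H \<Longrightarrow> ginv g \<in> H"
  by (rule subgroup.m_inv_closed[OF subgroup_H])

lemma mu_mu_in_H: "x \<in> E \<Longrightarrow> y \<in> E \<Longrightarrow> \<mu> x \<cdot> \<mu> y \<in> H"
  unfolding hua_subgroup_def by (blast intro: generate.incl)

text \<open>The generators of \<open>H\<close> contain no inverses of \<mu>-maps, but multiplying
  \<open>\<mu> x \<cdot> \<mu> y\<close> by the inverse of the generator
  \<open>\<mu> y \<cdot> \<mu> y\<close> produces one. This allows any \<mu>-map to be replaced by a
  fixed one modulo \<open>H\<close>.\<close>

lemma mu_inv_mu_in_H:
  assumes "x \<in> E" "y \<in> E" shows "\<mu> x \<cdot> ginv (\<mu> y) \<in> H"
proof -
  have "(\<mu> x \<cdot> \<mu> y) \<cdot> ginv (\<mu> y \<cdot> \<mu> y) \<in> H"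
    using assms mu_mu_in_H H_mult H_inv by blast
  then show ?thesis using assms mu_carrier by (simp add: word_simps)
qed

lemma inv_mu_inv_mu_in_H:
  assumes "x \<in> E" "y \<in> E" shows "ginv (\<mu> x) \<cdot> ginv (\<mu> y) \<in> H"
  using H_inv[OF mu_mu_in_H[OF assms(2,1)]] assms mu_carrier by (simp add: word_simps)

lemma H_props:
  assumes "h \<in> H" shows "h \<in> G" "h p0 = p0" "h pinf = pinf"
proof -
  have gen: "\<mu> x \<cdot> \<mu> y \<in> G \<and> (\<mu> x \<cdot> \<mu> y) p0 = p0 \<and> (\<mu> x \<cdot> \<mu> y) pinf = pinf"
    if "x \<in> E" "y \<in> E" for x y
    using that mu_in_G mu_props(2,3) G_mult mult_apply by metis
  have "h \<in> G \<and> h p0 = p0 \<and> h pinf = pinf"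
    using assms unfolding hua_subgroup_def
  proof (induction rule: generate.induct)
    case one
    then show ?case using subgroup.one_closed[OF subgroup_G] one_apply by blast
  next
    case (incl h)
    then show ?case using gen by blast
  next
    case (inv h)
    then have h: "h \<in> G" "h p0 = p0" "h pinf = pinf"
      using gen by blast+
    then show ?case using G_inv inv_apply[OF G_carrier] by metis
  next
    case (eng h1 h2)
    then show ?case using G_mult mult_apply by metis
  qed
  then show "h \<in> G" "h p0 = p0" "h pinf = pinf" by auto
qed

section \<open>Root elements nontrivial on classes as products around a \<mu>-map\<close>

text \<open>Condition \<open>n\<close> makes \<open>a p0\<close> a unit, and sharp transitivity of
  \<open>U pinf\<close> identifies \<open>a\<close> with the \<alpha>-element of that unit. Hence
  \<open>a\<close> itself is the middle factor of the corresponding \<mu>-map.\<close>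

lemma U_inf_decomp:
  assumes a: "a \<in> U pinf" and n: "(p0, a p0) \<notin> r"
  obtains x w v where "x \<in> E" "w \<in> U p0" "v \<in> U p0" "\<mu> x = w \<cdot> a \<cdot> v"
proof -
  have ac: "a \<in> carrier S" using a root_carrier pinf by blast
  have x: "a p0 \<in> E"
    using apply_in[OF ac p0] n root_nrel[OF pinf p0 nrel' a] rel_sym by (auto simp: units_def)
  have "alpha U p0 pinf (a p0) \<in> U pinf" "alpha U p0 pinf (a p0) p0 = a p0"
    using alpha_props[OF p0 pinf nrel] x by (auto simp: units_def)
  then have "alpha U p0 pinf (a p0) = a"
    using root_unique[OF pinf p0 nrel' _ a] by blast
  then show ?thesis using that mu_props(1)[OF x] x by auto
qed

lemma U_inf_mu:
  assumes a: "a \<in> U pinf" and n: "(p0, a p0) \<notin> r"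
  obtains x w v where "x \<in> E" "w \<in> U p0" "v \<in> U p0" "a = w \<cdot> \<mu> x \<cdot> v"
proof -
  obtain x w v where xwv: "x \<in> E" "w \<in> U p0" "v \<in> U p0" "\<mu> x = w \<cdot> a \<cdot> v"
    using U_inf_decomp[OF assms] .
  have "a = ginv w \<cdot> \<mu> x \<cdot> ginv v"
    using xwv root_carrier p0 pinf a by (simp add: word_simps)
  then show ?thesis using that xwv root_inv p0 by blast
qed

text \<open>The definition of \<mu>-maps treats the base points asymmetrically, so this dual form
  needs its own argument: \<open>a\<close> is chosen in \<open>U pinf\<close> so that the left
  factor of its \<mu>-map is forced to be \<open>u\<close>, and the right factor is then conjugated
  across the \<mu>-map into \<open>U pinf\<close>.\<close>

lemma U_0_mu:
  assumes u: "u \<in> U p0" and n: "(pinf, u pinf) \<notin> r"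
  obtains x a b where "x \<in> E" "a \<in> U pinf" "b \<in> U pinf" "u = a \<cdot> \<mu> x \<cdot> b"
proof -
  define z where "z = u pinf"
  have z: "z \<in> X" "(p0, z) \<notin> r" "(pinf, z) \<notin> r"
    using apply_in root_carrier u p0 pinf n root_nrel[OF p0 pinf nrel u] by (auto simp: z_def)
  obtain a where a: "a \<in> U pinf" "a z = p0" using ex_root[OF pinf z(1) p0 z(3) nrel'] .
  have ac: "a \<in> carrier S" using a root_carrier pinf by blast
  have "(p0, a p0) \<notin> r" using apply_rel[OF ac z(1) p0] a(2) z(2) rel_sym by auto
  then obtain x w v where xwv: "x \<in> E" "w \<in> U p0" "v \<in> U p0" "\<mu> x = w \<cdot> a \<cdot> v"
    using U_inf_decomp[OF a(1)] by blast
  have c: "w \<in> carrier S" "v \<in> carrier S" using xwv root_carrier p0 by auto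
  \<comment> \<open>Both sides equal \<open>p0\<close>, since \<open>v\<close> fixes
    \<open>p0\<close> and \<open>\<mu> x\<close> maps \<open>pinf\<close> there. Injectivity then
    gives \<open>w pinf = z\<close>.\<close>
  have "v (a (w pinf)) = v (a z)"
    using mu_props(3)[OF xwv(1)] a(2) LM2_fix[OF p0 xwv(3)] by (simp add: xwv(4) mult_apply)
  then have "w pinf = u pinf" using c ac apply_eq_iff z_def by metis
  then have wu: "w = u" using root_unique[OF p0 pinf nrel xwv(2) u] by blast
  have "\<mu> x \<cdot> ginv v \<cdot> ginv (\<mu> x) \<in> U pinf"
    using root_conj_inv[OF pinf mu_in_G[OF xwv(1)] root_inv[OF p0 xwv(3)]] mu_props(3)[OF xwv(1)] by simp
  moreover have "u = (\<mu> x \<cdot> ginv v \<cdot> ginv (\<mu> x)) \<cdot> \<mu> x \<cdot> ginv a"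
    using c ac wu xwv(4) by (simp add: word_simps)
  ultimately show ?thesis using that xwv(1) root_inv[OF pinf a(1)] by blast
qed

section \<open>The product of the root group of 0 with the Hua subgroup\<close>

definition K where "K = U p0 <#>\<^bsub>S\<^esub> H"

lemma K_iff: "k \<in> K \<longleftrightarrow> (\<exists>u\<in>U p0. \<exists>h\<in>H. k = u \<cdot> h)"
  by (auto simp: K_def set_mult_def)

lemma K_in_G: "k \<in> K \<Longrightarrow> k \<in> G"
  unfolding K_iff using root_in_G p0 H_props(1) G_mult by blast

lemma K_carrier: "k \<in> K \<Longrightarrow> k \<in> carrier S"
  using K_in_G G_carrier by blast

lemma K_fix: "k \<in> K \<Longrightarrow> k p0 = p0"
  unfolding K_iff using LM2_fix[OF p0] H_props(2) mult_apply by metis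

lemma H_in_K: "h \<in> H \<Longrightarrow> h \<in> K"
  using root_one[OF p0] H_carrier S.l_one unfolding K_iff by metis

lemma U_0_in_K: "u \<in> U p0 \<Longrightarrow> u \<in> K"
  using subgroup.one_closed[OF subgroup_H] root_carrier[OF p0] S.r_one unfolding K_iff by metis

text \<open>Elements of \<open>H\<close> lie in \<open>G\<close> and fix \<open>p0\<close>, so by
  \<open>LM3\<close> they normalize \<open>U p0\<close>; this moves the \<open>H\<close>-part of
  \<open>k\<close> past the root part of \<open>l\<close>.\<close>

lemma K_mult:
  assumes "k \<in> K" "l \<in> K" shows "k \<cdot> l \<in> K"
proof -
  obtain u h where k: "u \<in> U p0" "h \<in> H" "k = u \<cdot> h" using assms K_iff by blast
  obtain v g where l: "v \<in> U p0" "g \<in> H" "l = v \<cdot> g" using assms K_iff by blast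
  have "h \<cdot> v \<cdot> ginv h \<in> U p0"
    using root_conj_inv[OF p0 H_props(1)[OF k(2)] l(1)] H_props(2)[OF k(2)] by simp
  then have "u \<cdot> (h \<cdot> v \<cdot> ginv h) \<in> U p0" using root_mult p0 k by blast
  moreover have "h \<cdot> g \<in> H" using H_mult k l by blast
  moreover have "k \<cdot> l = u \<cdot> (h \<cdot> v \<cdot> ginv h) \<cdot> (h \<cdot> g)"
    using k l root_carrier p0 H_carrier by (simp add: word_simps)
  ultimately show ?thesis unfolding K_iff by blast
qed

text \<open>A \<mu>-map interchanges the base points, so by \<open>LM3\<close> conjugation by it
  interchanges their root groups. This pushes root elements to the right of a \<mu>-map.\<close>

lemma mu_conj_0:
  assumes "x \<in> E" "u \<in> U p0" obtains a where "a \<in> U pinf" "u \<cdot> \<mu> x = \<mu> x \<cdot> a"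
proof
  show "ginv (\<mu> x) \<cdot> u \<cdot> \<mu> x \<in> U pinf"
    using root_conj[OF p0 mu_in_G] mu_props(2) assms by blast
  show "u \<cdot> \<mu> x = \<mu> x \<cdot> (ginv (\<mu> x) \<cdot> u \<cdot> \<mu> x)"
    using assms mu_carrier root_carrier p0 by (simp add: word_simps)
qed

lemma mu_conj_inf:
  assumes "x \<in> E" "a \<in> U pinf" obtains u where "u \<in> U p0" "a \<cdot> \<mu> x = \<mu> x \<cdot> u"
proof
  show "ginv (\<mu> x) \<cdot> a \<cdot> \<mu> x \<in> U p0"
    using root_conj[OF pinf mu_in_G] mu_props(3) assms by blast
  show "a \<cdot> \<mu> x = \<mu> x \<cdot> (ginv (\<mu> x) \<cdot> a \<cdot> \<mu> x)"
    using assms mu_carrier root_carrier pinf by (simp add: word_simps)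
qed

section \<open>Products of an element of \<open>U pinf\<close> trivial on classes with an element of
  \<open>U p0\<close>\<close>

text \<open>Writing \<open>u = c \<cdot> \<mu> x \<cdot> b\<close>, the element
  \<open>a \<cdot> c\<close> is nontrivial on classes and so contributes a second \<mu>-map. The two
  \<mu>-maps are brought together by conjugating the root element between them, and their product
  lies in \<open>H\<close>.\<close>

lemma kernel_mult_U_0_generic:
  assumes a: "a \<in> U pinf" "(p0, a p0) \<in> r" and u: "u \<in> U p0" "(pinf, u pinf) \<notin> r"
  shows "\<exists>k\<in>K. \<exists>b\<in>U pinf. a \<cdot> u = k \<cdot> b"
proof -
  obtain x c b where x: "x \<in> E" "c \<in> U pinf" "b \<in> U pinf" "u = c \<cdot> \<mu> x \<cdot> b"
    using U_0_mu[OF u] .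
  note car = root_carrier[OF p0] root_carrier[OF pinf] mu_carrier K_carrier
  have ac: "a \<cdot> c \<in> U pinf" using a x root_mult pinf by blast
  have "(p0, (a \<cdot> c) p0) \<notin> r"
  proof
    assume "(p0, (a \<cdot> c) p0) \<in> r"
    moreover have "(c p0, (a \<cdot> c) p0) \<in> r"
      using a x car apply_in p0 by (simp add: mult_apply apply_rel)
    ultimately have "(p0, c p0) \<in> r" using rel_sym rel_trans by blast
    \<comment> \<open>The second entry is \<open>u p0 = p0\<close>, while the first is
      \<open>pinf\<close>, as \<open>b\<close> fixes \<open>pinf\<close>.\<close>
    then have "(b (\<mu> x p0), b (\<mu> x (c p0))) \<in> r"
      using x car apply_in p0 by (simp add: apply_rel)
    moreover have "b (\<mu> x (c p0)) = p0" using LM2_fix[OF p0 u(1)] x(4) by (simp add: mult_apply)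
    moreover have "b (\<mu> x p0) = pinf" using mu_props(2) x LM2_fix[OF pinf] by simp
    ultimately show False using nrel' by simp
  qed
  then obtain y w v where y: "y \<in> E" "w \<in> U p0" "v \<in> U p0" "a \<cdot> c = w \<cdot> \<mu> y \<cdot> v"
    using U_inf_mu[OF ac] by blast
  obtain d where d: "d \<in> U pinf" "v \<cdot> \<mu> x = \<mu> x \<cdot> d" using mu_conj_0[OF x(1) y(3)] .
  have "a \<cdot> u = a \<cdot> c \<cdot> \<mu> x \<cdot> b" using a x car by (simp add: S.m_assoc)
  also have "\<dots> = w \<cdot> \<mu> y \<cdot> (v \<cdot> \<mu> x) \<cdot> b" using a x y car by (simp add: S.m_assoc)
  also have "\<dots> = w \<cdot> (\<mu> y \<cdot> \<mu> x) \<cdot> (d \<cdot> b)" using d x y car by (simp add: S.m_assoc)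
  finally have "a \<cdot> u = w \<cdot> (\<mu> y \<cdot> \<mu> x) \<cdot> (d \<cdot> b)" .
  moreover have "w \<cdot> (\<mu> y \<cdot> \<mu> x) \<in> K" using y x mu_mu_in_H K_iff by blast
  ultimately show ?thesis using root_mult[OF pinf d(1) x(3)] by blast
qed

text \<open>If \<open>u\<close> is trivial on classes, it is split as
  \<open>(u \<cdot> v) \<cdot> ginv v\<close> with \<open>v\<close> taking \<open>pinf\<close> to a
  unit. Neither factor is trivial on classes, so the generic case applies twice.\<close>

lemma kernel_mult_U_0:
  assumes a: "a \<in> U pinf" "(p0, a p0) \<in> r" and u: "u \<in> U p0"
  shows "\<exists>k\<in>K. \<exists>b\<in>U pinf. a \<cdot> u = k \<cdot> b"
proof (cases "(pinf, u pinf) \<in> r")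
  case False
  then show ?thesis using kernel_mult_U_0_generic assms by blast
next
  case True
  obtain e where e: "e \<in> E" using ex_unit by blast
  then have e': "e \<in> X" "(p0, e) \<notin> r" "(pinf, e) \<notin> r" using rel_sym by (auto simp: units_def)
  obtain v where v: "v \<in> U p0" "v pinf = e" using ex_root[OF p0 pinf e'(1) nrel e'(2)] .
  note car = root_carrier[OF p0] root_carrier[OF pinf] K_carrier
  have iv: "ginv v \<in> U p0" using root_inv p0 v by blast
  have "(pinf, ginv v pinf) \<notin> r"
    using apply_rel[OF car(1)[OF v(1)] pinf apply_in[OF car(1)[OF iv] pinf]] v(2) e'(3)
      apply_inv[OF car(1)[OF v(1)]] rel_sym by auto
  have w: "u \<cdot> v \<in> U p0" using root_mult p0 u v by blast
  have "(e, v (u pinf)) \<in> r"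
    using True apply_rel[OF car(1)[OF v(1)] pinf apply_in[OF car(1)[OF u] pinf]] v(2) by simp
  then have "(pinf, (u \<cdot> v) pinf) \<notin> r"
    using e'(3) rel_sym rel_trans by (metis mult_apply)
  then obtain k b where kb: "k \<in> K" "b \<in> U pinf" "a \<cdot> (u \<cdot> v) = k \<cdot> b"
    using kernel_mult_U_0_generic[OF a w] by blast
  \<comment> \<open>Since \<open>k\<close> fixes \<open>p0\<close>, comparing images of
    \<open>p0\<close> shows that \<open>b\<close> is again trivial on classes, as the second
    application requires.\<close>
  have "b p0 = (u \<cdot> v) (a p0)"
    using arg_cong[OF kb(3), of "\<lambda>g. g p0"] K_fix[OF kb(1)] by (simp add: mult_apply)
  then have "(p0, b p0) \<in> r"
    using a apply_rel[OF car(1)[OF w] p0 apply_in[OF car(2)[OF a(1)] p0]] LM2_fix[OF p0 w] by simp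
  then obtain l c where lc: "l \<in> K" "c \<in> U pinf" "b \<cdot> ginv v = l \<cdot> c"
    using kernel_mult_U_0_generic[OF kb(2) _ iv \<open>(pinf, ginv v pinf) \<notin> r\<close>] by blast
  have "a \<cdot> u = (a \<cdot> (u \<cdot> v)) \<cdot> ginv v" using a u v car by (simp add: word_simps)
  also have "\<dots> = k \<cdot> (b \<cdot> ginv v)" using kb v car by (simp add: word_simps)
  also have "\<dots> = (k \<cdot> l) \<cdot> c" using lc kb car by (simp add: word_simps)
  finally show ?thesis using K_mult kb lc by blast
qed

end

section \<open>The two-cell set for a fixed \<mu>-map and its stability\<close>

locale marked_local_moufang_set = based_local_moufang_set X r U p0 pinf
  for X :: "'a set" and r :: "('a \<times> 'a) set" and U :: "'a \<Rightarrow> ('a \<Rightarrow> 'a) set" and p0 pinf :: 'a +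
  fixes t :: 'a
  assumes t: "t \<in> E"
begin

abbreviation \<tau> where "\<tau> \<equiv> \<mu> t"

text \<open>The second cell carries all of \<open>U p0\<close> instead of its kernel, so that its
  stability under right multiplication by \<open>U p0\<close> is immediate. The kernel form is
  recovered in \<open>bruhat_decomposition\<close>.\<close>

definition Q where
  "Q = {k \<cdot> a | k a. k \<in> K \<and> a \<in> U pinf} \<union> {k \<cdot> \<tau> \<cdot> u | k u. k \<in> K \<and> u \<in> U p0}"

lemmas car = root_carrier[OF p0] root_carrier[OF pinf] K_carrier mu_carrier[OF t] H_carrier

lemma Q_cases:
  assumes "g \<in> Q"
  obtains k a where "g = k \<cdot> a" "k \<in> K" "a \<in> U pinf"
    | k u where "g = k \<cdot> \<tau> \<cdot> u" "k \<in> K" "u \<in> U p0"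
  using assms unfolding Q_def by blast

lemma Q_infI: "k \<in> K \<Longrightarrow> a \<in> U pinf \<Longrightarrow> k \<cdot> a \<in> Q"
  unfolding Q_def by blast

lemma Q_tauI: "k \<in> K \<Longrightarrow> u \<in> U p0 \<Longrightarrow> k \<cdot> \<tau> \<cdot> u \<in> Q"
  unfolding Q_def by blast

lemma Q_mult_U_0:
  assumes "g \<in> Q" "u \<in> U p0" shows "g \<cdot> u \<in> Q"
  using assms(1)
proof (cases rule: Q_cases)
  fix k a assume g: "g = k \<cdot> a" "k \<in> K" "a \<in> U pinf"
  show ?thesis
  proof (cases "(p0, a p0) \<in> r")
    case True
    then obtain l b where lb: "l \<in> K" "b \<in> U pinf" "a \<cdot> u = l \<cdot> b"
      using kernel_mult_U_0 g assms by blast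
    have "g \<cdot> u = k \<cdot> (a \<cdot> u)" using g assms car by (simp add: S.m_assoc)
    also have "\<dots> = (k \<cdot> l) \<cdot> b" using lb g car by (simp add: S.m_assoc)
    finally show ?thesis using lb g K_mult Q_infI by metis
  next
    case False
    then obtain x w v where x: "x \<in> E" "w \<in> U p0" "v \<in> U p0" "a = w \<cdot> \<mu> x \<cdot> v"
      using U_inf_mu g by blast
    \<comment> \<open>Here \<open>\<mu> x\<close> is exchanged for \<open>\<tau>\<close> at the cost
      of \<open>\<mu> x \<cdot> ginv \<tau>\<close>, an element of \<open>H\<close>.\<close>
    have "g \<cdot> u = (k \<cdot> (w \<cdot> (\<mu> x \<cdot> ginv \<tau>))) \<cdot> \<tau> \<cdot> (v \<cdot> u)"
      using g x assms car mu_carrier by (simp add: word_simps)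
    moreover have "k \<cdot> (w \<cdot> (\<mu> x \<cdot> ginv \<tau>)) \<in> K"
      using K_mult g(2) K_iff x mu_inv_mu_in_H t by blast
    ultimately show ?thesis using root_mult p0 x assms Q_tauI by metis
  qed
next
  fix k v assume g: "g = k \<cdot> \<tau> \<cdot> v" "k \<in> K" "v \<in> U p0"
  then have "g \<cdot> u = k \<cdot> \<tau> \<cdot> (v \<cdot> u)" using assms car by (simp add: S.m_assoc)
  then show ?thesis using Q_tauI g root_mult p0 assms by metis
qed

lemma Q_mult_tau:
  assumes "g \<in> Q" shows "g \<cdot> \<tau> \<in> Q"
  using assms
proof (cases rule: Q_cases)
  fix k a assume g: "g = k \<cdot> a" "k \<in> K" "a \<in> U pinf"
  obtain u where u: "u \<in> U p0" "a \<cdot> \<tau> = \<tau> \<cdot> u" using mu_conj_inf t g by blast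
  then have "g \<cdot> \<tau> = k \<cdot> \<tau> \<cdot> u" using g car by (simp add: S.m_assoc)
  then show ?thesis using Q_tauI g u by metis
next
  fix k v assume g: "g = k \<cdot> \<tau> \<cdot> v" "k \<in> K" "v \<in> U p0"
  obtain a where a: "a \<in> U pinf" "v \<cdot> \<tau> = \<tau> \<cdot> a" using mu_conj_0 t g by blast
  have "g \<cdot> \<tau> = (k \<cdot> (\<tau> \<cdot> \<tau>)) \<cdot> a" using a g car by (simp add: S.m_assoc)
  moreover have "k \<cdot> (\<tau> \<cdot> \<tau>) \<in> K" using K_mult g H_in_K mu_mu_in_H t by blast
  ultimately show ?thesis using Q_infI a by metis
qed

lemma Q_mult_inv_tau:
  assumes "g \<in> Q" shows "g \<cdot> ginv \<tau> \<in> Q"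
  using assms
proof (cases rule: Q_cases)
  fix k a assume g: "g = k \<cdot> a" "k \<in> K" "a \<in> U pinf"
  have "\<tau> \<cdot> a \<cdot> ginv \<tau> \<in> U p0"
    using root_conj_inv[OF p0 mu_in_G g(3)] t mu_props(2) by blast
  \<comment> \<open>The inverse of \<open>\<tau>\<close> is \<open>\<tau>\<close> preceded by its
    inverse square, which lies in \<open>H\<close>.\<close>
  moreover have "g \<cdot> ginv \<tau> = (k \<cdot> (ginv \<tau> \<cdot> ginv \<tau>)) \<cdot> \<tau> \<cdot> (\<tau> \<cdot> a \<cdot> ginv \<tau>)"
    using g car by (simp add: word_simps)
  moreover have "k \<cdot> (ginv \<tau> \<cdot> ginv \<tau>) \<in> K"
    using K_mult g H_in_K inv_mu_inv_mu_in_H t by blast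
  ultimately show ?thesis using Q_tauI by metis
next
  fix k v assume g: "g = k \<cdot> \<tau> \<cdot> v" "k \<in> K" "v \<in> U p0"
  have "\<tau> \<cdot> v \<cdot> ginv \<tau> \<in> U pinf"
    using root_conj_inv[OF pinf mu_in_G g(3)] t mu_props(3) by blast
  moreover have "g \<cdot> ginv \<tau> = k \<cdot> (\<tau> \<cdot> v \<cdot> ginv \<tau>)"
    using g car by (simp add: word_simps)
  ultimately show ?thesis using Q_infI g by metis
qed

lemma Q_eq_G: "Q = G"
proof
  show "Q \<subseteq> G"
    unfolding Q_def using K_in_G root_in_G[OF p0] root_in_G[OF pinf] mu_in_G[OF t] G_mult by blast
  \<comment> \<open>\<open>R\<close> collects the right multipliers preserving \<open>Q\<close>. It
    is closed under products; closure under inverses is not evident, which is why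
    \<open>ginv \<tau>\<close> is treated separately.\<close>
  define R where "R = {g \<in> carrier S. \<forall>q\<in>Q. q \<cdot> g \<in> Q}"
  have Qc: "q \<in> carrier S" if "q \<in> Q" for q
    using \<open>Q \<subseteq> G\<close> G_carrier that by blast
  have R_mult: "g \<cdot> h \<in> R" if "g \<in> R" "h \<in> R" for g h
    using that Qc by (auto simp: R_def simp flip: S.m_assoc)
  have R0: "U p0 \<subseteq> R" using Q_mult_U_0 car by (auto simp: R_def)
  have Rtau: "\<tau> \<in> R" "ginv \<tau> \<in> R" using Q_mult_tau Q_mult_inv_tau car by (auto simp: R_def)
  have Rinf: "U pinf \<subseteq> R"
  proof
    fix a assume a: "a \<in> U pinf"
    have "\<tau> \<cdot> a \<cdot> ginv \<tau> \<in> U p0"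
      using root_conj_inv[OF p0 mu_in_G a] t mu_props(2) by blast
    then have "ginv \<tau> \<cdot> (\<tau> \<cdot> a \<cdot> ginv \<tau>) \<cdot> \<tau> \<in> R" using R0 Rtau R_mult by blast
    then show "a \<in> R" using a car by (simp add: word_simps)
  qed
  have conj: "U x \<subseteq> R" if g: "U y \<subseteq> R" "U z \<subseteq> R" "g \<in> U y" "g z = x" "y \<in> X" "z \<in> X" for x y z g
  proof
    fix u assume u: "u \<in> U x"
    have gG: "g \<in> G" using root_in_G g by blast
    have "g \<cdot> u \<cdot> ginv g \<in> R" using root_conj_inv[OF g(6) gG u g(4)] g(2) by blast
    moreover have "ginv g \<in> R" "g \<in> R" using root_inv g by blast+
    ultimately have "ginv g \<cdot> (g \<cdot> u \<cdot> ginv g) \<cdot> g \<in> R" using R_mult by blast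
    moreover have "u \<in> carrier S" using u g apply_in G_carrier[OF gG] root_carrier by blast
    ultimately show "u \<in> R" using G_carrier[OF gG] by (simp add: word_simps)
  qed
  \<comment> \<open>No point is equivalent to both base points. Hence \<open>x\<close> is the image
    of one base point under the root group of the other, and \<open>U x\<close> is a conjugate of a
    root group already in \<open>R\<close>.\<close>
  have RU: "U x \<subseteq> R" if x: "x \<in> X" for x
  proof (cases "(pinf, x) \<in> r")
    case False
    then obtain g where "g \<in> U pinf" "g p0 = x" using ex_root[OF pinf p0 x nrel'] by blast
    then show ?thesis using conj Rinf R0 p0 pinf by blast
  next
    case True
    then have "(p0, x) \<notin> r" using nrel rel_sym rel_trans by blast
    then obtain g where "g \<in> U p0" "g pinf = x" using ex_root[OF p0 pinf x nrel] by blast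
    then show ?thesis using conj Rinf R0 p0 pinf by blast
  qed
  have GR: "G \<subseteq> R"
  proof
    fix g assume "g \<in> G"
    then show "g \<in> R" unfolding little_projective_group_def
    proof (induction rule: generate.induct)
      case one
      then show ?case using R0 root_one p0 by blast
    next
      case (incl h)
      then show ?case using RU by blast
    next
      case (inv h)
      then show ?case using RU root_inv by blast
    next
      case (eng h1 h2)
      then show ?case using R_mult by blast
    qed
  qed
  show "G \<subseteq> Q"
  proof
    fix g assume g: "g \<in> G"
    have "\<one>\<^bsub>S\<^esub> \<in> Q"
      using Q_infI[OF U_0_in_K[OF root_one[OF p0]] root_one[OF pinf]] by simp
    then have "\<one>\<^bsub>S\<^esub> \<cdot> g \<in> Q" using GR g by (auto simp: R_def)
    then show "g \<in> Q" using G_carrier[OF g] by simp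
  qed
qed

section \<open>The decomposition of the little projective group and the stabilizers\<close>

lemma bruhat_decomposition:
  "G = (K <#>\<^bsub>S\<^esub> U pinf) \<union> (K #>\<^bsub>S\<^esub> \<tau> <#>\<^bsub>S\<^esub> root_kernel X r U p0)"
proof -
  have "Q \<subseteq> {k \<cdot> a | k a. k \<in> K \<and> a \<in> U pinf}
    \<union> {k \<cdot> \<tau> \<cdot> u | k u. k \<in> K \<and> u \<in> root_kernel X r U p0}" (is "_ \<subseteq> ?A \<union> ?B")
  proof
    fix g assume "g \<in> Q"
    then show "g \<in> ?A \<union> ?B"
    proof (cases rule: Q_cases)
      fix k a assume "g = k \<cdot> a" "k \<in> K" "a \<in> U pinf"
      then show ?thesis by blast
    next
      fix k u assume g: "g = k \<cdot> \<tau> \<cdot> u" "k \<in> K" "u \<in> U p0"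
      show ?thesis
      proof (cases "(pinf, u pinf) \<in> r")
        case True
        then have "u \<in> root_kernel X r U p0" using root_kernel_iff[OF p0 pinf nrel] g by blast
        then show ?thesis using g by blast
      next
        case False
        then obtain x a b where x: "x \<in> E" "a \<in> U pinf" "b \<in> U pinf" "u = a \<cdot> \<mu> x \<cdot> b"
          using U_0_mu g by blast
        \<comment> \<open>An element of the second cell whose \<open>u\<close> is nontrivial on
          classes falls into the first: in
          \<open>\<tau> \<cdot> a \<cdot> \<mu> x \<cdot> b\<close>, conjugating \<open>a\<close> to
          the left of \<open>\<tau>\<close> leaves \<open>\<tau> \<cdot> \<mu> x\<close> in
          \<open>H\<close>.\<close>
        have "\<tau> \<cdot> a \<cdot> ginv \<tau> \<in> U p0"
          using root_conj_inv[OF p0 mu_in_G x(2)] t mu_props(2) by blast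
        then have "k \<cdot> ((\<tau> \<cdot> a \<cdot> ginv \<tau>) \<cdot> (\<tau> \<cdot> \<mu> x)) \<in> K"
          using K_mult g(2) K_iff mu_mu_in_H t x by blast
        moreover have "g = k \<cdot> ((\<tau> \<cdot> a \<cdot> ginv \<tau>) \<cdot> (\<tau> \<cdot> \<mu> x)) \<cdot> b"
          using g x car mu_carrier by (simp add: word_simps)
        ultimately show ?thesis using x by blast
      qed
    qed
  qed
  moreover have "?A \<union> ?B \<subseteq> Q"
    unfolding Q_def using root_kernel_iff[OF p0 pinf nrel] by blast
  ultimately have "Q = ?A \<union> ?B" by (rule subset_antisym)
  then have "G = ?A \<union> ?B" unfolding Q_eq_G .
  also have "\<dots> = (K <#>\<^bsub>S\<^esub> U pinf) \<union> (K #>\<^bsub>S\<^esub> \<tau> <#>\<^bsub>S\<^esub> root_kernel X r U p0)"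
    by (auto simp: set_mult_def r_coset_def)
  finally show ?thesis .
qed

text \<open>In the first cell, fixing \<open>p0\<close> forces \<open>a\<close> to be trivial by
  sharp transitivity. In the second, \<open>p0\<close> is sent to \<open>u pinf\<close>, which is
  never equivalent to \<open>p0\<close>.\<close>

lemma stabilizer: "{g \<in> G. g p0 = p0} = K"
proof
  show "K \<subseteq> {g \<in> G. g p0 = p0}" using K_in_G K_fix by blast
  show "{g \<in> G. g p0 = p0} \<subseteq> K"
  proof
    fix g assume "g \<in> {g \<in> G. g p0 = p0}"
    then have g: "g \<in> Q" "g p0 = p0" using Q_eq_G by auto
    from g(1) show "g \<in> K"
    proof (cases rule: Q_cases)
      fix k a assume k: "g = k \<cdot> a" "k \<in> K" "a \<in> U pinf"
      then have "a p0 = \<one>\<^bsub>S\<^esub> p0" using g(2) K_fix[OF k(2)] by (simp add: k(1) mult_apply one_apply)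
      then have "a = \<one>\<^bsub>S\<^esub>" using root_unique[OF pinf p0 nrel' k(3) root_one[OF pinf]] by blast
      then show ?thesis using k car by simp
    next
      fix k u assume k: "g = k \<cdot> \<tau> \<cdot> u" "k \<in> K" "u \<in> U p0"
      then have "u pinf = p0" using g(2) K_fix[OF k(2)] mu_props(2)[OF t] by (simp add: k(1) mult_apply)
      then show ?thesis using root_nrel[OF p0 pinf nrel k(3)] rel_refl p0 by simp
    qed
  qed
qed

text \<open>In the factorization \<open>g = u \<cdot> h\<close> given by \<open>stabilizer\<close>,
  \<open>h\<close> fixes \<open>pinf\<close>; so \<open>u\<close> does too, and sharp transitivity
  of \<open>U p0\<close> makes \<open>u\<close> trivial.\<close>

lemma two_point_stabilizer: "H = {g \<in> G. g p0 = p0 \<and> g pinf = pinf}"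
proof
  show "H \<subseteq> {g \<in> G. g p0 = p0 \<and> g pinf = pinf}" using H_props by blast
  show "{g \<in> G. g p0 = p0 \<and> g pinf = pinf} \<subseteq> H"
  proof
    fix g assume "g \<in> {g \<in> G. g p0 = p0 \<and> g pinf = pinf}"
    then have "g \<in> K" and g: "g pinf = pinf" using stabilizer by auto
    then obtain u h where uh: "u \<in> U p0" "h \<in> H" "g = u \<cdot> h" using K_iff by blast
    have "h (u pinf) = h pinf" using g H_props(3)[OF uh(2)] by (simp add: uh(3) mult_apply)
    then have "u pinf = \<one>\<^bsub>S\<^esub> pinf" using apply_eq_iff H_carrier uh by (simp add: one_apply)
    then have "u = \<one>\<^bsub>S\<^esub>" using root_unique[OF p0 pinf nrel uh(1) root_one[OF p0]] by blast
    then show "g \<in> H" using uh H_carrier by simp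
  qed
qed

end

theorem theorem3p7:
  fixes X :: "'a set" and r :: "('a \<times> 'a) set" and U :: "'a \<Rightarrow> ('a \<Rightarrow> 'a) set"
    and p0 pinf :: 'a and \<tau> :: "'a \<Rightarrow> 'a"
  assumes "local_moufang_set X r U"
    and "p0 \<in> X" and "pinf \<in> X" and "(p0, pinf) \<notin> r"
    and "\<tau> \<in> mu_maps X r U p0 pinf"
  shows "little_projective_group X r U =
           (U p0 <#>\<^bsub>sym_rel X r\<^esub> hua_subgroup X r U p0 pinf <#>\<^bsub>sym_rel X r\<^esub> U pinf) \<union>
           (U p0 <#>\<^bsub>sym_rel X r\<^esub> hua_subgroup X r U p0 pinf #>\<^bsub>sym_rel X r\<^esub> \<tau>
              <#>\<^bsub>sym_rel X r\<^esub> root_kernel X r U p0)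
       \<and> {g \<in> little_projective_group X r U. g p0 = p0} =
           U p0 <#>\<^bsub>sym_rel X r\<^esub> hua_subgroup X r U p0 pinf
       \<and> hua_subgroup X r U p0 pinf = {g \<in> little_projective_group X r U. g p0 = p0 \<and> g pinf = pinf}"
proof -
  obtain t where mu_t: "t \<in> units X r p0 pinf" "\<tau> = mu X r U p0 pinf t"
    using assms(5) by (auto simp: mu_maps_def)
  interpret local_moufang_set X r U by fact
  interpret marked_local_moufang_set X r U p0 pinf t
    by unfold_locales (use assms mu_t in auto)
  show ?thesis
    using bruhat_decomposition stabilizer two_point_stabilizer
    unfolding mu_t(2) K_def by (intro conjI)
qed

end
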